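(* Let $\Omega\subset\mathbb{R}^d$ be compact, $T>0$, and let $P=\{\mathcal{P}_1,\dots,\mathcal{P}_K\}$ be a finite family of pairwise disjoint open convex polyhedra $\mathcal{P}_k=\{x\in\mathbb{R}^d: A_kx<b_k\}$ with $$\Omega\setminus\Gamma_P=\bigcup_{k=1}^K(\Omega\cap\mathcal{P}_k).$$ Let $F:\Omega\times\mathbb{R}\to\mathbb{R}^d$ be piecewise smooth with respect to $P$. Then for every $\varepsilon>0$ there exists $\mathcal{N}\in\mathcal{F}_P^d$ such that $$\sup_{x\in\Omega\setminus\Gamma_P,\ t\in[0,T]}\|F(x,t)-\mathcal{N}(x,t)\|_\infty<\varepsilon.$$
   Context: Activations. $\operatorname{ReLU}(x)=\max\{0,x\}$ and $\mathcal{H}$ is the Heaviside function with $\mathcal{H}(r)=1$ for $r\ge0$ and $\mathcal{H}(r)=0$ for $r<0$; both are applied componentwise to vectors. For $J\in\mathbb{R}^k$, $\operatorname{ReLU}_J:\mathbb{R}^k\to\mathbb{R}^k$ is $\operatorname{ReLU}_J(x)=\operatorname{ReLU}(x)+J\odot\mathcal{H}(x)$, with $\odot$ the componentwise product. Network classes. For $d_1,d_2\in\mathbb{N}$, $\mathcal{F}_{\operatorname{ReLU}_J}^{d_1,d_2}$ is the set of all maps $\mathbb{R}^{d_1}\to\mathbb{R}^{d_2}$ of the form $W_L\circ\operatorname{ReLU}_{J_L}\circ\cdots\circ W_1\circ\operatorname{ReLU}_{J_1}\circ W_0$ with $L\in\mathbb{N}$, $W_\ell:\mathbb{R}^{h_\ell}\to\mathbb{R}^{h_{\ell+1}}$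 affine for $\ell=0,\dots,L$, $J_\ell\in\mathbb{R}^{h_\ell}$ for $\ell=1,\dots,L$, $h_0=d_1$, $h_{L+1}=d_2$, and $h_1,\dots,h_L\in\mathbb{N}$ (depth, widths, affine maps and jump vectors are all arbitrary). $\mathcal{F}_{\operatorname{ReLU}}^{d_1,d_2}\subset\mathcal{F}_{\operatorname{ReLU}_J}^{d_1,d_2}$ is the subclass in which all $J_\ell=0$. Geometry. For $P=\{\mathcal{P}_1,\dots,\mathcal{P}_K\}$ with $\mathcal{P}_k=\{x\in\mathbb{R}^d:A_kx<b_k\}$ (componentwise inequality), $A_k\in\mathbb{R}^{m_k\times d}$, $b_k\in\mathbb{R}^{m_k}$, set $d_P=\sum_{k=1}^Km_k$; let $A_P$ and $b_P$ be the vertical stackings of $A_1,\dots,A_K$ and of $b_1,\dots,b_K$; $T_P(x)=b_P-A_Px\in\mathbb{R}^{d_P}$; $z_P(x)=\mathcal{H}(T_P(x))\in\{0,1\}^{d_P}$; and $\Gamma_P=\bigcup_{\ell=1}^{d_P}\{x\in\mathbb{R}^d:(T_P(x))_\ell=0\}$. Geometry-preserving class. $\mathcal{F}_P^d$ is the set of maps $\mathbb{R}^d\times\mathbb{R}\to\mathbb{R}^d$, $(x,t)\mapsto\Psi(x,t,\Phi(z_P(x)))$, with $\Phi\in\mathcal{F}_{\operatorname{ReLU}_J}^{d_P,d_1}$, $\Psi\in\mathcal{F}_{\operatorname{ReLU}}^{1+d+d_1,d}$, $d_1\in\mathbb{N}$. Piecewise smooth. $F:\Omega\times\mathbb{R}\to\mathbb{R}^d$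 is piecewise smooth with respect to $P$ if for every $k\in\{1,\dots,K\}$ there is a map $F_k:\overline{\Omega\cap\mathcal{P}_k}\times\mathbb{R}\to\mathbb{R}^d$ that is continuous on $\overline{\Omega\cap\mathcal{P}_k}\times\mathbb{R}$, smooth on $(\Omega\cap\mathcal{P}_k)\times\mathbb{R}$, and satisfies $F(x,t)=F_k(x,t)$ for all $x\in\Omega\cap\mathcal{P}_k$, $t\in\mathbb{R}$. *)

theory Defs
  imports "HOL-Analysis.Analysis" "HOL-Library.Disjoint_Sets" "Jordan_Normal_Form.Matrix"
begin

text \<open>
  The ambient space is the Euclidean space \<^typ>\<open>real^'d\<close>.  Vectors of the hidden layers, whose
  dimensions vary, are of type \<^typ>\<open>real Matrix.vec\<close> with carriers \<^term>\<open>carrier_vec n\<close>.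
\<close>

no_notation vec_nth (infixl \<open>$\<close> 90)


subsection \<open>Coordinates\<close>

text \<open>
  A finite index type carries no canonical order, so an enumeration of it is fixed arbitrarily.
  The network classes below are invariant under permutations of the input and output coordinates
  (which are absorbed by the first and last affine maps), so the choice is irrelevant.
\<close>

definition coord_enum :: "nat \<Rightarrow> 'd::finite" where
  "coord_enum = (SOME e. bij_betw e {..<CARD('d)} UNIV)"

lemma bij_betw_coord_enum: "bij_betw (coord_enum :: nat \<Rightarrow> 'd::finite) {..<CARD('d)} UNIV"
proof -
  have "\<exists>e. bij_betw e {..<CARD('d)} (UNIV :: 'd set)"
    using ex_bij_betw_nat_finite[of "UNIV :: 'd set"] by (simp add: lessThan_atLeast0)
  then show ?thesis
    unfolding coord_enum_def by (rule someI_ex)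
qed

definition coords :: "real^'d::finite \<Rightarrow> real Matrix.vec" where
  "coords x = Matrix.vec CARD('d) (\<lambda>i. vec_nth x (coord_enum i))"

lemma bij_betw_coords: "bij_betw coords (UNIV :: (real^'d::finite) set) (carrier_vec CARD('d))"
proof (rule bij_betwI[where g = "\<lambda>v. vec_lambda (\<lambda>j. v $ inv_into {..<CARD('d)} coord_enum j)"])
  show "coords \<in> (UNIV :: (real^'d) set) \<rightarrow> carrier_vec CARD('d)"
    by (auto simp: coords_def)
  note inv_right = bij_betw_inv_into_right[OF bij_betw_coord_enum]
    and inv_left = bij_betw_inv_into_left[OF bij_betw_coord_enum]
  have inv_less: "inv_into {..<CARD('d)} coord_enum j < CARD('d)" for j :: 'd
    using bij_betw_apply[OF bij_betw_inv_into[OF bij_betw_coord_enum], of j] by simp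
  show "vec_lambda (\<lambda>j. coords x $ inv_into {..<CARD('d)} coord_enum j) = x" for x :: "real^'d"
    by (simp add: coords_def vec_eq_iff inv_less inv_right)
  show "coords (vec_lambda (\<lambda>j. v $ inv_into {..<CARD('d)} coord_enum j) :: real^'d) = v"
    if "v \<in> carrier_vec CARD('d)" for v
    using that by (intro eq_vecI) (auto simp: coords_def inv_left)
qed auto


subsection \<open>Activations and network classes\<close>

definition relu :: "real \<Rightarrow> real" where
  "relu r = max 0 r"

definition heaviside :: "real \<Rightarrow> real" where
  "heaviside r = (if r \<ge> 0 then 1 else 0)"

definition relu_jump :: "real Matrix.vec \<Rightarrow> real Matrix.vec \<Rightarrow> real Matrix.vec" where
  "relu_jump J x = Matrix.vec (dim_vec x) (\<lambda>i. relu (x $ i) + J $ i * heaviside (x $ i))"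

definition affine_maps :: "nat \<Rightarrow> nat \<Rightarrow> (real Matrix.vec \<Rightarrow> real Matrix.vec) set" where
  "affine_maps n m = {W. \<exists>A \<in> carrier_mat m n. \<exists>c \<in> carrier_vec m.
     \<forall>x \<in> carrier_vec n. W x = A *\<^sub>v x + c}"

primrec net :: "(nat \<Rightarrow> real Matrix.vec \<Rightarrow> real Matrix.vec) \<Rightarrow> (nat \<Rightarrow> real Matrix.vec) \<Rightarrow> nat
    \<Rightarrow> real Matrix.vec \<Rightarrow> real Matrix.vec" where
  "net W J 0 = W 0"
| "net W J (Suc l) = W (Suc l) \<circ> relu_jump (J (Suc l)) \<circ> net W J l"

text \<open>
  \<open>\<J> n\<close> is the set of jump vectors admitted in a layer of width \<open>n\<close>.  A map from the
  \<open>d1\<close>-dimensional to the \<open>d2\<close>-dimensional space is represented by any function with the right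
  values on \<^term>\<open>carrier_vec d1\<close>.
\<close>

definition nets :: "(nat \<Rightarrow> real Matrix.vec set) \<Rightarrow> nat \<Rightarrow> nat
    \<Rightarrow> (real Matrix.vec \<Rightarrow> real Matrix.vec) set" where
  "nets \<J> d1 d2 = {f. \<exists>L h W J. L \<ge> 1 \<and> h 0 = d1 \<and> h (Suc L) = d2 \<and>
     (\<forall>l\<in>{1..L}. h l \<ge> 1) \<and>
     (\<forall>l\<in>{0..L}. W l \<in> affine_maps (h l) (h (Suc l))) \<and>
     (\<forall>l\<in>{1..L}. J l \<in> \<J> (h l)) \<and>
     (\<forall>x \<in> carrier_vec d1. f x = net W J L x)}"

definition relu_jump_nets :: "nat \<Rightarrow> nat \<Rightarrow> (real Matrix.vec \<Rightarrow> real Matrix.vec) set" where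
  "relu_jump_nets = nets carrier_vec"

definition relu_nets :: "nat \<Rightarrow> nat \<Rightarrow> (real Matrix.vec \<Rightarrow> real Matrix.vec) set" where
  "relu_nets = nets (\<lambda>n. {0\<^sub>v n})"


subsection \<open>Polyhedral geometry\<close>

text \<open>
  A system \<open>A x < b\<close> of \<open>m\<close> strict inequalities is the list of length \<open>m\<close> of its rows \<open>(a, \<beta>)\<close>,
  where \<open>a\<close> is a row of \<open>A\<close> and \<open>\<beta>\<close> the corresponding entry of \<open>b\<close>.  A family \<open>P\<close> of polyhedra is
  a list of such systems, so that \<^term>\<open>concat P\<close> is the vertical stacking of all of them and its
  length is \<open>d\<^sub>P\<close>.
\<close>

type_synonym 'd ineqs = "((real^'d) \<times> real) list"

definition open_polyhedron :: "'d::finite ineqs \<Rightarrow> (real^'d) set" where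
  "open_polyhedron R = {x. \<forall>(a, \<beta>) \<in> set R. inner a x < \<beta>}"

definition dim_geom :: "'d::finite ineqs list \<Rightarrow> nat" where
  "dim_geom P = length (concat P)"

definition T_geom :: "'d::finite ineqs list \<Rightarrow> real^'d \<Rightarrow> real Matrix.vec" where
  "T_geom P x = vec_of_list (map (\<lambda>(a, \<beta>). \<beta> - inner a x) (concat P))"

definition z_geom :: "'d::finite ineqs list \<Rightarrow> real^'d \<Rightarrow> real Matrix.vec" where
  "z_geom P x = map_vec heaviside (T_geom P x)"

definition Gamma_geom :: "'d::finite ineqs list \<Rightarrow> (real^'d) set" where
  "Gamma_geom P = (\<Union>l<dim_geom P. {x. T_geom P x $ l = 0})"

definition geom_preserving_nets :: "'d::finite ineqs list \<Rightarrow> ((real^'d) \<times> real \<Rightarrow> real^'d) set" where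
  "geom_preserving_nets P = {N. \<exists>d1 \<ge> 1.
     \<exists>\<Phi> \<in> relu_jump_nets (dim_geom P) d1. \<exists>\<Psi> \<in> relu_nets (1 + CARD('d) + d1) CARD('d).
       \<forall>x t. coords (N (x, t)) = \<Psi> (coords x @\<^sub>v vec_of_list [t] @\<^sub>v \<Phi> (z_geom P x))}"


subsection \<open>Piecewise smooth maps\<close>

text \<open>
  \<open>Ck_on_open k U f\<close> is meant for open \<open>U\<close>: all iterated directional derivatives up to order \<open>k\<close>
  exist (as values of Frechet derivatives) and are continuous.
\<close>

primrec Ck_on_open :: "nat \<Rightarrow> 'a::real_normed_vector set \<Rightarrow> ('a \<Rightarrow> 'b::real_normed_vector) \<Rightarrow> bool"
where
  "Ck_on_open 0 U f \<longleftrightarrow> continuous_on U f"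
| "Ck_on_open (Suc k) U f \<longleftrightarrow> (\<forall>x\<in>U. f differentiable at x) \<and>
     (\<forall>v. Ck_on_open k U (\<lambda>x. frechet_derivative f (at x) v))"

text \<open>
  On a set that need not be open, smoothness means the existence of local smooth extensions; for
  open \<open>S\<close> this is ordinary smoothness.
\<close>

definition smooth_on :: "'a::real_normed_vector set \<Rightarrow> ('a \<Rightarrow> 'b::real_normed_vector) \<Rightarrow> bool" where
  "smooth_on S f \<longleftrightarrow> (\<forall>p\<in>S. \<exists>U g. open U \<and> p \<in> U \<and> (\<forall>k. Ck_on_open k U g) \<and>
     (\<forall>q \<in> S \<inter> U. f q = g q))"

definition piecewise_smooth ::
  "(real^'d::finite) set \<Rightarrow> 'd ineqs list \<Rightarrow> ((real^'d) \<times> real \<Rightarrow> real^'d) \<Rightarrow> bool" where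
  "piecewise_smooth \<Omega> P F \<longleftrightarrow> (\<forall>k<length P. \<exists>Fk :: (real^'d) \<times> real \<Rightarrow> real^'d.
     continuous_on (closure (\<Omega> \<inter> open_polyhedron (P ! k)) \<times> UNIV) Fk \<and>
     smooth_on ((\<Omega> \<inter> open_polyhedron (P ! k)) \<times> UNIV) Fk \<and>
     (\<forall>x \<in> \<Omega> \<inter> open_polyhedron (P ! k). \<forall>t. F (x, t) = Fk (x, t)))"

end

theory Submission
  imports Defs
begin

text \<open>
  Reading the binary vector \<open>z\<^sub>P(x)\<close> as a binary number gives a linear functional \<open>c(x)\<close> of it with
  finitely many values, which off \<open>\<Gamma>\<^sub>P\<close> determines the polyhedron containing \<open>x\<close>.  So on each level
  set \<open>S\<^sub>c\<close> of this code (off \<open>\<Gamma>\<^sub>P\<close>) the map \<open>F\<close> coincides with one of the continuous maps \<open>F\<^sub>k\<close>, and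
  \<open>(x, t, c) \<longmapsto> F\<^sub>k (x, t)\<close> is continuous on the compact union of the disjoint pieces
  \<open>closure S\<^sub>c \<times> [0, T] \<times> {c}\<close>, because these lie at different heights.  A ReLU
  network \<open>\<Psi>\<close> approximates it there uniformly, and \<open>\<Phi>\<close> only has to compute the
  code.
\<close>

subsection \<open>Scalar functions computed by ReLU networks\<close>

text \<open>Scalar outputs of networks with \<open>k\<close> hidden layers. The neurons are indexed
  by the functions they compute, so that two networks are combined by taking a union of sets, and
  widths and matrices enter only in \<open>relu_layer_realization\<close>.\<close>

primrec relu_layer :: "nat \<Rightarrow> nat \<Rightarrow> (real Matrix.vec \<Rightarrow> real) set" where
  "relu_layer n 0 = {\<lambda>x. c + (\<Sum>i<n. w i * x $ i) | c w. True}"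
| "relu_layer n (Suc k) =
     {\<lambda>x. c + (\<Sum>g\<in>G. w g * relu (g x)) | c w G. finite G \<and> G \<subseteq> relu_layer n k}"

lemma relu_layer_const: "(\<lambda>x. c) \<in> relu_layer n k"
proof (cases k)
  case 0
  then show ?thesis by (auto intro!: exI[of _ c] exI[of _ "\<lambda>_. 0"])
next
  case (Suc j)
  then show ?thesis by (auto intro!: exI[of _ c] exI[of _ "{}"])
qed

lemma relu_layer_scale:
  assumes "f \<in> relu_layer n k"
  shows "(\<lambda>x. r * f x) \<in> relu_layer n k"
proof (cases k)
  case 0
  with assms obtain c w where f: "f = (\<lambda>x. c + (\<Sum>i<n. w i * x $ i))" by auto
  have "(\<lambda>x. r * f x) = (\<lambda>x. r * c + (\<Sum>i<n. (r * w i) * x $ i))"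
    unfolding f by (simp add: distrib_left sum_distrib_left mult.assoc)
  then show ?thesis
    unfolding 0 relu_layer.simps by (intro CollectI exI conjI TrueI)
next
  case (Suc j)
  with assms obtain c w G where f: "f = (\<lambda>x. c + (\<Sum>g\<in>G. w g * relu (g x)))"
    and G: "finite G" "G \<subseteq> relu_layer n j" by auto
  have "(\<lambda>x. r * f x) = (\<lambda>x. r * c + (\<Sum>g\<in>G. (r * w g) * relu (g x)))"
    unfolding f by (simp add: distrib_left sum_distrib_left mult.assoc)
  then show ?thesis
    unfolding Suc relu_layer.simps using G by (intro CollectI exI conjI)
qed

text \<open>Zero weights pad a combination to a larger set of neurons, which lets several outputs
  share one hidden layer.\<close>

lemma sum_relu_superset:
  assumes "finite H" "G \<subseteq> H"
  shows "(\<Sum>g\<in>G. w g * relu (g x)) = (\<Sum>g\<in>H. (if g \<in> G then w g else 0) * relu (g x))"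
  using assms by (intro sum.mono_neutral_cong_left) auto

lemma relu_layer_add:
  assumes "f \<in> relu_layer n k" "g \<in> relu_layer n k"
  shows "(\<lambda>x. f x + g x) \<in> relu_layer n k"
proof (cases k)
  case 0
  with assms obtain c w c' w' where f: "f = (\<lambda>x. c + (\<Sum>i<n. w i * x $ i))"
    and g: "g = (\<lambda>x. c' + (\<Sum>i<n. w' i * x $ i))" by auto
  have "(\<lambda>x. f x + g x) = (\<lambda>x. (c + c') + (\<Sum>i<n. (w i + w' i) * x $ i))"
    unfolding f g by (simp add: distrib_right sum.distrib algebra_simps)
  then show ?thesis
    unfolding 0 relu_layer.simps by (intro CollectI exI conjI TrueI)
next
  case (Suc j)
  with assms obtain c w G c' w' G' where f: "f = (\<lambda>x. c + (\<Sum>g\<in>G. w g * relu (g x)))"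
    and g: "g = (\<lambda>x. c' + (\<Sum>g\<in>G'. w' g * relu (g x)))"
    and G: "finite G" "G \<subseteq> relu_layer n j" and G': "finite G'" "G' \<subseteq> relu_layer n j" by auto
  have fin: "finite (G \<union> G')" using G G' by simp
  have "(\<lambda>x. f x + g x) = (\<lambda>x. (c + c') + (\<Sum>g\<in>G \<union> G'.
      ((if g \<in> G then w g else 0) + (if g \<in> G' then w' g else 0)) * relu (g x)))"
    unfolding f g sum_relu_superset[OF fin Un_upper1] sum_relu_superset[OF fin Un_upper2]
    by (simp only: distrib_right sum.distrib add_ac)
  moreover have "G \<union> G' \<subseteq> relu_layer n j" using G G' by simp
  ultimately show ?thesis
    unfolding Suc relu_layer.simps using fin by (intro CollectI exI conjI)
qed

lemma relu_layer_relu: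
  assumes "f \<in> relu_layer n k"
  shows "(\<lambda>x. relu (f x)) \<in> relu_layer n (Suc k)"
proof -
  have "(\<lambda>x. relu (f x)) = (\<lambda>x. 0 + (\<Sum>g\<in>{f}. 1 * relu (g x)))" by simp
  moreover have "finite {f}" "{f} \<subseteq> relu_layer n k" using assms by auto
  ultimately show ?thesis
    unfolding relu_layer.simps by (intro CollectI exI conjI)
qed

text \<open>The identity \<open>f = relu f - relu (- f)\<close> lets an extra layer pass a value
  through unchanged.\<close>

lemma relu_layer_Suc: "relu_layer n k \<subseteq> relu_layer n (Suc k)"
proof
  fix f assume f: "f \<in> relu_layer n k"
  have "(\<lambda>x. relu (f x) + (-1) * relu ((-1) * f x)) \<in> relu_layer n (Suc k)"
    using f by (intro relu_layer_add relu_layer_scale relu_layer_relu)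
  moreover have "(\<lambda>x. relu (f x) + (-1) * relu ((-1) * f x)) = f"
    by (auto simp: relu_def max_def)
  ultimately show "f \<in> relu_layer n (Suc k)" by (simp only:)
qed

lemma relu_layer_mono: "k \<le> l \<Longrightarrow> relu_layer n k \<subseteq> relu_layer n l"
  by (rule lift_Suc_mono_le[of "relu_layer n"]) (rule relu_layer_Suc)


subsection \<open>Networks computing a finite family of scalar functions\<close>

lemma net_cong:
  assumes "\<And>l. l \<le> L \<Longrightarrow> W l = W' l" "\<And>l. 1 \<le> l \<Longrightarrow> l \<le> L \<Longrightarrow> J l = J' l"
  shows "net W J L = net W' J' L"
  using assms by (induction L) auto

lemma affine_maps_matrix:
  "(\<lambda>x. Matrix.mat m n (\<lambda>(i, j). w i j) *\<^sub>v x + Matrix.vec m c) \<in> affine_maps n m"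
  unfolding affine_maps_def
  by (auto intro!: bexI[of _ "Matrix.mat m n (\<lambda>(i, j). w i j)"] bexI[of _ "Matrix.vec m c"])

lemma matrix_affine_eq:
  assumes "x \<in> carrier_vec n"
  shows "Matrix.mat m n (\<lambda>(i, j). w i j) *\<^sub>v x + Matrix.vec m c
    = Matrix.vec m (\<lambda>i. c i + (\<Sum>j<n. w i j * x $ j))"
  using assms by (intro eq_vecI) (auto simp: scalar_prod_def lessThan_atLeast0 add.commute)

text \<open>The neurons used by all the outputs are pooled into one finite set; its enumeration is
  again a finite family, one layer lower, to which the induction hypothesis applies. This is why
  whole families are treated rather than single functions.\<close>

lemma relu_layer_realization:
  assumes "\<And>i. i < m \<Longrightarrow> f i \<in> relu_layer n k"
  shows "\<exists>h W. h 0 = n \<and> h (Suc k) = m \<and> (\<forall>l\<in>{1..k}. h l \<ge> 1) \<and>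
    (\<forall>l\<in>{0..k}. W l \<in> affine_maps (h l) (h (Suc l))) \<and>
    (\<forall>x\<in>carrier_vec n. Matrix.vec m (\<lambda>i. f i x) = net W (\<lambda>l. 0\<^sub>v (h l)) k x)"
  using assms
proof (induction k arbitrary: m f)
  case 0
  have "\<exists>c w. f i = (\<lambda>x. c + (\<Sum>j<n. w j * x $ j))" if "i < m" for i
    using 0[OF that] by simp
  then have "\<forall>i. \<exists>c w. i < m \<longrightarrow> f i = (\<lambda>x. c + (\<Sum>j<n. w j * x $ j))" by blast
  then obtain c w where f: "\<And>i. i < m \<Longrightarrow> f i = (\<lambda>x. c i + (\<Sum>j<n. w i j * x $ j))"
    unfolding choice_iff by blast
  define W where
    "W = (\<lambda>l::nat. \<lambda>x. Matrix.mat m n (\<lambda>(i, j). w i j) *\<^sub>v x + Matrix.vec m c)"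
  \<comment> \<open>Only the widths at positions 0 and 1 matter here; the value \<open>m\<close>
    further on is a filler.\<close>
  show ?case
    by (rule exI[of _ "\<lambda>l. if l = 0 then n else m"], rule exI[of _ W])
      (auto simp: W_def affine_maps_matrix matrix_affine_eq f intro!: eq_vecI)
next
  case (Suc k)
  have "\<exists>c w G. f i = (\<lambda>x. c + (\<Sum>g\<in>G. w g * relu (g x))) \<and> finite G \<and> G \<subseteq> relu_layer n k"
    if "i < m" for i
    using Suc.prems[OF that] by simp
  then have "\<forall>i. \<exists>c w G. i < m \<longrightarrow> f i = (\<lambda>x. c + (\<Sum>g\<in>G. w g * relu (g x))) \<and>
      finite G \<and> G \<subseteq> relu_layer n k" by blast
  then obtain c w G where f: "\<And>i. i < m \<Longrightarrow> f i = (\<lambda>x. c i + (\<Sum>g\<in>G i. w i g * relu (g x)))"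
    and G: "\<And>i. i < m \<Longrightarrow> finite (G i)" "\<And>i. i < m \<Longrightarrow> G i \<subseteq> relu_layer n k"
    unfolding choice_iff by blast
  \<comment> \<open>the constant function makes sure that the new hidden layer has positive width\<close>
  define H where "H = insert (\<lambda>x. 0) (\<Union>i<m. G i)"
  have H: "finite H" "H \<subseteq> relu_layer n k"
    using G by (auto simp: H_def relu_layer_const)
  obtain e where e: "bij_betw e {..<card H} H"
    using ex_bij_betw_nat_finite[OF H(1)] by (auto simp: lessThan_atLeast0)
  define v where "v i j = (if e j \<in> G i then w i (e j) else 0)" for i j
  have f': "f i x = c i + (\<Sum>j<card H. v i j * relu (e j x))" if "i < m" for i x
  proof -
    have "f i x = c i + (\<Sum>g\<in>H. (if g \<in> G i then w i g else 0) * relu (g x))"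
      using that H(1) by (subst sum_relu_superset[symmetric]) (auto simp: H_def f)
    then show ?thesis
      by (simp add: sum.reindex_bij_betw[OF e, symmetric] v_def)
  qed
  have "e j \<in> relu_layer n k" if "j < card H" for j
    using bij_betwE[OF e] H(2) that by auto
  from Suc.IH[of "card H" e, OF this] obtain h W where hW: "h 0 = n" "h (Suc k) = card H"
      "\<forall>l\<in>{1..k}. h l \<ge> 1" "\<forall>l\<in>{0..k}. W l \<in> affine_maps (h l) (h (Suc l))"
      "\<forall>x\<in>carrier_vec n. Matrix.vec (card H) (\<lambda>j. e j x) = net W (\<lambda>l. 0\<^sub>v (h l)) k x"
    by auto
  define W0 where
    "W0 = (\<lambda>x. Matrix.mat m (card H) (\<lambda>(i, j). v i j) *\<^sub>v x + Matrix.vec m c)"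
  define h' where "h' = h(Suc (Suc k) := m)"
  define W' where "W' = W(Suc k := W0)"
  \<comment> \<open>The updates at \<open>W (Suc k)\<close> and \<open>h (Suc (Suc k))\<close> lie
    beyond everything that the first \<open>k\<close> layers read.\<close>
  have cong: "net W' (\<lambda>l. 0\<^sub>v (h' l)) k = net W (\<lambda>l. 0\<^sub>v (h l)) k"
    by (rule net_cong) (auto simp: W'_def h'_def)
  have "card H \<ge> 1"
    using H(1) by (simp add: Suc_le_eq card_gt_0_iff H_def)
  then have "\<forall>l\<in>{1..Suc k}. h' l \<ge> 1"
    using hW(2,3) by (auto simp: h'_def le_Suc_eq)
  moreover have "\<forall>l\<in>{0..Suc k}. W' l \<in> affine_maps (h' l) (h' (Suc l))"
    using hW(2,4) by (auto simp: h'_def W'_def W0_def le_Suc_eq affine_maps_matrix)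
  moreover have "\<forall>x\<in>carrier_vec n.
      Matrix.vec m (\<lambda>i. f i x) = net W' (\<lambda>l. 0\<^sub>v (h' l)) (Suc k) x"
  proof
    fix x :: "real Matrix.vec" assume x: "x \<in> carrier_vec n"
    have "relu_jump (0\<^sub>v (h' (Suc k))) (net W' (\<lambda>l. 0\<^sub>v (h' l)) k x)
        = Matrix.vec (card H) (\<lambda>j. relu (e j x))"
      using x hW(2) unfolding cong
      by (intro eq_vecI) (auto simp: relu_jump_def h'_def simp flip: hW(5))
    then have "net W' (\<lambda>l. 0\<^sub>v (h' l)) (Suc k) x = W0 (Matrix.vec (card H) (\<lambda>j. relu (e j x)))"
      by (simp only: net.simps comp_apply) (simp only: W'_def fun_upd_same)
    also have "\<dots> = Matrix.vec m
        (\<lambda>i. c i + (\<Sum>j<card H. v i j * Matrix.vec (card H) (\<lambda>j. relu (e j x)) $ j))"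
      unfolding W0_def by (rule matrix_affine_eq) simp
    also have "\<dots> = Matrix.vec m (\<lambda>i. f i x)"
      by (rule eq_vecI) (auto simp: f')
    finally show "Matrix.vec m (\<lambda>i. f i x) = net W' (\<lambda>l. 0\<^sub>v (h' l)) (Suc k) x" ..
  qed
  ultimately show ?case
    using hW(1) by (intro exI[of _ h'] exI[of _ W']) (auto simp: h'_def)
qed

section \<open>Scalar network functions of arbitrary depth\<close>

definition relu_funs :: "nat \<Rightarrow> (real Matrix.vec \<Rightarrow> real) set" where
  "relu_funs n = (\<Union>k. relu_layer n k)"

lemma relu_funs_affine: "(\<lambda>x. c + (\<Sum>i<n. w i * x $ i)) \<in> relu_funs n"
  unfolding relu_funs_def by (rule UN_I[of 0]) auto

lemma relu_funs_const: "(\<lambda>x. c) \<in> relu_funs n"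
  using relu_layer_const unfolding relu_funs_def by blast

lemma relu_funs_scale: "f \<in> relu_funs n \<Longrightarrow> (\<lambda>x. r * f x) \<in> relu_funs n"
  by (auto simp: relu_funs_def intro: relu_layer_scale)

lemma relu_funs_relu: "f \<in> relu_funs n \<Longrightarrow> (\<lambda>x. relu (f x)) \<in> relu_funs n"
  unfolding relu_funs_def using relu_layer_relu by blast

text \<open>The sum of the individual depths is a common upper bound. Its successor makes the depth
  positive, as \<open>nets\<close> demands at least one hidden layer.\<close>

lemma relu_funs_common_layer:
  fixes m :: nat
  assumes "\<And>i. i < m \<Longrightarrow> f i \<in> relu_funs n"
  shows "\<exists>k\<ge>1. \<forall>i<m. f i \<in> relu_layer n k"
proof -
  from assms obtain k where k: "\<And>i. i < m \<Longrightarrow> f i \<in> relu_layer n (k i)"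
    unfolding relu_funs_def UN_iff by metis
  have "f i \<in> relu_layer n (Suc (\<Sum>i<m. k i))" if "i < m" for i
  proof -
    have "k i \<le> (\<Sum>i<m. k i)" using that by (intro member_le_sum[of i "{..<m}" k]) auto
    then show ?thesis using k[OF that] relu_layer_mono[of "k i" "Suc (\<Sum>i<m. k i)" n]
      by (meson le_Suc_eq subsetD)
  qed
  then show ?thesis by (intro exI[of _ "Suc (\<Sum>i<m. k i)"]) simp
qed

lemma relu_funs_add:
  assumes "f \<in> relu_funs n" "g \<in> relu_funs n"
  shows "(\<lambda>x. f x + g x) \<in> relu_funs n"
proof -
  obtain k l where "f \<in> relu_layer n k" "g \<in> relu_layer n l"
    using assms by (auto simp: relu_funs_def)
  then have "f \<in> relu_layer n (max k l)" "g \<in> relu_layer n (max k l)"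
    using relu_layer_mono[of k "max k l" n] relu_layer_mono[of l "max k l" n] by auto
  then show ?thesis
    by (auto simp: relu_funs_def intro: relu_layer_add)
qed

lemma relu_funs_realization:
  assumes "\<And>i. i < m \<Longrightarrow> f i \<in> relu_funs n"
  shows "(\<lambda>x. Matrix.vec m (\<lambda>i. f i x)) \<in> relu_nets n m"
proof -
  obtain k where k: "k \<ge> 1" "\<And>i. i < m \<Longrightarrow> f i \<in> relu_layer n k"
    using relu_funs_common_layer assms by blast
  obtain h W where "h 0 = n" "h (Suc k) = m" "\<forall>l\<in>{1..k}. h l \<ge> 1"
    "\<forall>l\<in>{0..k}. W l \<in> affine_maps (h l) (h (Suc l))"
    "\<forall>x\<in>carrier_vec n. Matrix.vec m (\<lambda>i. f i x) = net W (\<lambda>l. 0\<^sub>v (h l)) k x"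
    using relu_layer_realization[of m f n k, OF k(2)] by auto
  with k(1) show ?thesis
    unfolding relu_nets_def nets_def
    by (intro CollectI exI[of _ k] exI[of _ h] exI[of _ W] exI[of _ "\<lambda>l. 0\<^sub>v (h l)"]) auto
qed

lemma relu_nets_subset_relu_jump_nets: "relu_nets n m \<subseteq> relu_jump_nets n m"
proof
  fix f assume "f \<in> relu_nets n m"
  then obtain L h W J where net: "L \<ge> 1" "h 0 = n" "h (Suc L) = m" "\<forall>l\<in>{1..L}. h l \<ge> 1"
    "\<forall>l\<in>{0..L}. W l \<in> affine_maps (h l) (h (Suc l))" "\<forall>l\<in>{1..L}. J l \<in> {0\<^sub>v (h l)}"
    "\<forall>x\<in>carrier_vec n. f x = net W J L x"
    unfolding relu_nets_def nets_def mem_Collect_eq by (elim exE conjE) (rule that)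
  have "\<forall>l\<in>{1..L}. J l \<in> carrier_vec (h l)" using net(6) by auto
  with net show "f \<in> relu_jump_nets n m"
    unfolding relu_jump_nets_def nets_def mem_Collect_eq by (intro exI conjI)
qed


subsection \<open>Universal approximation\<close>

text \<open>
  On a compact set a continuous \<open>g\<close> is close to \<open>\<lambda>x. Max {g y - M * \<parallel>x - y\<parallel>\<^sub>1 | y \<in> Y}\<close>,
  where \<open>Y\<close> is a fine finite net and \<open>M\<close> is so large that the peaks at points far from \<open>x\<close>
  do not contribute.
\<close>

lemma relu_closed_dense:
  fixes A :: "('a::euclidean_space \<Rightarrow> real) set"
  assumes const: "\<And>c. (\<lambda>x. c) \<in> A"
    and inner: "\<And>b. (\<lambda>x. inner x b) \<in> A"
    and add: "\<And>f g. f \<in> A \<Longrightarrow> g \<in> A \<Longrightarrow> (\<lambda>x. f x + g x) \<in> A"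
    and scale: "\<And>r f. f \<in> A \<Longrightarrow> (\<lambda>x. r * f x) \<in> A"
    and relu: "\<And>f. f \<in> A \<Longrightarrow> (\<lambda>x. relu (f x)) \<in> A"
    and C: "compact C" and g: "continuous_on C g" and e: "e > 0"
  shows "\<exists>q\<in>A. \<forall>x\<in>C. \<bar>g x - q x\<bar> < e"
proof (cases "C = {}")
  case True
  then show ?thesis using const by auto
next
  case False
  \<comment> \<open>This is the distance in the 1-norm; unlike the Euclidean distance it is built
    from affine functions and absolute values, hence lies in \<open>A\<close>.\<close>
  define \<phi> :: "'a \<Rightarrow> 'a \<Rightarrow> real" where "\<phi> y x = (\<Sum>b\<in>Basis. \<bar>inner (x - y) b\<bar>)" for y x
  have abs: "(\<lambda>x. \<bar>f x\<bar>) \<in> A" if "f \<in> A" for f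
  proof -
    have "(\<lambda>x. relu (f x) + relu ((-1) * f x)) \<in> A"
      using that by (intro add scale relu)
    moreover have "(\<lambda>x. relu (f x) + relu ((-1) * f x)) = (\<lambda>x. \<bar>f x\<bar>)"
      by (auto simp: relu_def max_def)
    ultimately show ?thesis by (simp only:)
  qed
  have max: "(\<lambda>x. max (f x) (h x)) \<in> A" if "f \<in> A" "h \<in> A" for f h
  proof -
    have "(\<lambda>x. f x + relu (h x + (-1) * f x)) \<in> A"
      using that by (intro add scale relu)
    moreover have "(\<lambda>x. f x + relu (h x + (-1) * f x)) = (\<lambda>x. max (f x) (h x))"
      by (auto simp: relu_def max_def)
    ultimately show ?thesis by (simp only:)
  qed
  have sum: "(\<lambda>x. \<Sum>i\<in>I. f i x) \<in> A" if "finite I" "\<And>i. i \<in> I \<Longrightarrow> f i \<in> A"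
    for f and I :: "'a set"
    using that by (induction I rule: finite_induct) (auto intro: const add)
  have Max: "(\<lambda>x. Max ((\<lambda>y. f y x) ` Y)) \<in> A" if "finite Y" "Y \<noteq> {}" "\<And>y. y \<in> Y \<Longrightarrow> f y \<in> A"
    for f and Y :: "'a set"
    using that
  proof (induction Y rule: finite_ne_induct)
    case (insert y Y)
    then show ?case by (simp add: max)
  qed auto
  have \<phi>: "\<phi> y \<in> A" for y
  proof -
    have "(\<lambda>x. \<Sum>b\<in>Basis. \<bar>inner x b + - inner y b\<bar>) \<in> A"
      by (intro sum abs add inner const) auto
    then show ?thesis by (simp add: \<phi>_def[abs_def] inner_diff_left)
  qed
  have \<phi>_ge: "dist x y \<le> \<phi> y x" for x y
    unfolding \<phi>_def dist_norm by (rule norm_le_l1)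
  have \<phi>_le: "\<phi> y x \<le> DIM('a) * dist x y" for x y
    unfolding \<phi>_def dist_norm by (rule sum_bounded_above) (rule Basis_le_norm)
  obtain B where B: "B > 0" "\<And>x. x \<in> C \<Longrightarrow> \<bar>g x\<bar> \<le> B"
    using compact_imp_bounded[OF compact_continuous_image[OF g C]]
    by (auto simp: bounded_pos)
  obtain \<delta> where \<delta>: "\<delta> > 0" "\<And>x y. x \<in> C \<Longrightarrow> y \<in> C \<Longrightarrow> dist x y < \<delta> \<Longrightarrow> \<bar>g x - g y\<bar> < e / 3"
    using compact_uniformly_continuous[OF g C] e
    unfolding uniformly_continuous_on_def dist_real_def
    by (metis divide_pos_pos zero_less_numeral)
  \<comment> \<open>At distance at least \<delta> the penalty \<open>M * \<phi> y x\<close> is at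
    least \<open>2 * B\<close>, so the peak at \<open>y\<close> is at most
    \<open>B - 2 * B = - B\<close>, which is at most \<open>g x\<close>.\<close>
  define M where "M = 2 * B / \<delta>"
  have M: "M > 0" "M * \<delta> = 2 * B" using B \<delta> by (auto simp: M_def)
  \<comment> \<open>The bound \<delta> gives uniform continuity between \<open>x\<close> and its
    nearest net point; the other bound keeps the penalty there below \<open>e / 3\<close>, the
    factor \<open>DIM('a)\<close> coming from the comparison of the two norms.\<close>
  define \<eta> where "\<eta> = min \<delta> (e / (3 * M * DIM('a)))"
  have \<eta>: "\<eta> > 0" using \<delta> e M by (auto simp: \<eta>_def)
  obtain Y where Y: "finite Y" "Y \<subseteq> C" "C \<subseteq> (\<Union>y\<in>Y. ball y \<eta>)"
    using compactE_image[OF C, of C "\<lambda>y. ball y \<eta>"] \<eta> by (metis UN_I centre_in_ball open_ball subsetI)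
  have "Y \<noteq> {}" using Y False by auto
  define q where "q x = Max ((\<lambda>y. g y + (- M) * \<phi> y x) ` Y)" for x
  have "q \<in> A"
    unfolding q_def[abs_def] using Y \<open>Y \<noteq> {}\<close> by (intro Max add const scale \<phi>)
  moreover have "\<bar>g x - q x\<bar> < e" if x: "x \<in> C" for x
  proof -
    \<comment> \<open>No peak overshoots: near \<open>x\<close> uniform continuity suffices because
      the penalty is nonnegative, and far from \<open>x\<close> the penalty cancels the oscillation
      of \<open>g\<close>.\<close>
    have "g y + (- M) * \<phi> y x \<le> g x + e / 3" if y: "y \<in> C" for y
    proof (cases "dist x y < \<delta>")
      case True
      have "0 \<le> M * \<phi> y x" using M \<phi>_ge[of x y] zero_le_dist[of x y] by (intro mult_nonneg_nonneg) linarith+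
      then show ?thesis using \<delta>(2)[OF x y True] by linarith
    next
      case False
      have "M * \<delta> \<le> M * \<phi> y x"
        using M False \<phi>_ge[of x y] by (intro mult_left_mono) auto
      then show ?thesis using B(2)[OF x] B(2)[OF y] M(2) e by auto
    qed
    then have up: "q x \<le> g x + e / 3"
      unfolding q_def using Y \<open>Y \<noteq> {}\<close> by (subst Max_le_iff) auto
    obtain y where y: "y \<in> Y" "dist x y < \<eta>" using Y x by (auto simp: dist_commute)
    have "M * \<phi> y x \<le> M * (DIM('a) * \<eta>)"
      using M y \<phi>_le[of y x] by (intro mult_left_mono order_trans[OF \<phi>_le]) auto
    also have "\<dots> \<le> M * (DIM('a) * (e / (3 * M * DIM('a))))"
      using M by (intro mult_left_mono) (auto simp: \<eta>_def)
    also have "\<dots> = e / 3" using M by simp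
    finally have "M * \<phi> y x \<le> e / 3" .
    moreover have "\<bar>g x - g y\<bar> < e / 3"
      using \<delta>(2)[of x y] y x Y(2) by (auto simp: \<eta>_def)
    ultimately have "g x - 2 * (e / 3) < g y + (- M) * \<phi> y x" by linarith
    also have "\<dots> \<le> q x"
      unfolding q_def using Y y by (intro Max_ge) auto
    finally show ?thesis using up e by auto
  qed
  ultimately show ?thesis by blast
qed

text \<open>The nesting of the appended vectors copies the input of \<open>\<Psi>\<close> in
  \<open>geom_preserving_nets\<close>, with a single real code in the place of the output of
  \<open>\<Phi>\<close>.\<close>

definition flat :: "(real^'d::finite) \<times> real \<times> real \<Rightarrow> real Matrix.vec" where
  "flat = (\<lambda>(x, t, s). coords x @\<^sub>v vec_of_list [t] @\<^sub>v vec_of_list [s])"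

lemma flat_carrier: "flat (p :: (real^'d::finite) \<times> real \<times> real) \<in> carrier_vec (1 + CARD('d) + 1)"
  by (rule carrier_vecI) (simp add: flat_def coords_def case_prod_unfold)

lemma coords_scalar_prod: "scalar_prod (coords x) (coords y) = inner x y"
  unfolding coords_def scalar_prod_def inner_vec_def
  by (simp add: sum.reindex_bij_betw[OF bij_betw_coord_enum, symmetric] lessThan_atLeast0)

text \<open>As \<open>flat\<close> preserves inner products, every linear functional on the product
  space becomes a linear combination of the entries of the flattened vector, that is, a network
  function without hidden layers.\<close>

lemma flat_scalar_prod: "scalar_prod (flat p) (flat q) = inner p q"
  proof -
  have "dim_vec (coords x) = CARD('d)" for x :: "real^'d" by (simp add: coords_def)
  then have coords: "coords x \<in> carrier_vec CARD('d)" for x :: "real^'d" by (metis carrier_vec_dim_vec)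
  have last: "vec_of_list [t] @\<^sub>v vec_of_list [s] \<in> carrier_vec (1 + 1)" for t s :: real
    by simp
  show ?thesis
    unfolding flat_def inner_prod_def case_prod_unfold
      scalar_prod_append[OF coords last coords last] coords_scalar_prod
    by simp
qed

text \<open>The network functions composed with \<open>flat\<close> form a class with the closure
  properties required by \<open>relu_closed_dense\<close>.\<close>

lemma relu_funs_dense:
  fixes g :: "(real^'d::finite) \<times> real \<times> real \<Rightarrow> real"
  assumes "compact C" "continuous_on C g" "e > 0"
  shows "\<exists>f\<in>relu_funs (1 + CARD('d) + 1). \<forall>p\<in>C. \<bar>g p - f (flat p)\<bar> < e"
proof -
  let ?n = "1 + CARD('d) + 1"
  let ?A = "(\<lambda>f p. f (flat p)) ` relu_funs ?n :: ((real^'d) \<times> real \<times> real \<Rightarrow> real) set"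
  have A: "(\<lambda>p. f (flat p)) \<in> ?A" if "f \<in> relu_funs ?n" for f
    using that by (rule imageI)
  have "\<exists>q\<in>?A. \<forall>x\<in>C. \<bar>g x - q x\<bar> < e"
  proof (rule relu_closed_dense[OF _ _ _ _ _ assms])
    show "(\<lambda>x. c) \<in> ?A" for c
      by (rule A[of "\<lambda>x. c"]) (rule relu_funs_const)
    show "(\<lambda>x. inner x b) \<in> ?A" for b
    proof -
      have "dim_vec (flat p) = ?n" for p :: "(real^'d) \<times> real \<times> real"
        by (rule carrier_vecD) (rule flat_carrier)
      then have "inner p b = 0 + (\<Sum>i<?n. flat b $ i * flat p $ i)" for p
        unfolding inner_commute[of p b] flat_scalar_prod[symmetric] scalar_prod_def
        by (simp only: lessThan_atLeast0 add_0 mult.commute)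
      then show ?thesis
        by (simp only:) (intro A[of "\<lambda>x. 0 + (\<Sum>i<?n. flat b $ i * x $ i)"] relu_funs_affine)
    qed
    show "(\<lambda>x. f x + h x) \<in> ?A" if "f \<in> ?A" "h \<in> ?A" for f h
      using that
    proof (elim imageE, hypsubst)
      fix f h assume "f \<in> relu_funs ?n" "h \<in> relu_funs ?n"
      then show "(\<lambda>p. f (flat p) + h (flat p)) \<in> ?A"
        by (intro A[of "\<lambda>x. f x + h x"] relu_funs_add)
    qed
    show "(\<lambda>x. r * f x) \<in> ?A" if "f \<in> ?A" for r f
      using that
    proof (elim imageE, hypsubst)
      fix f assume "f \<in> relu_funs ?n"
      then show "(\<lambda>p. r * f (flat p)) \<in> ?A"
        by (intro A[of "\<lambda>x. r * f x"] relu_funs_scale)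
    qed
    show "(\<lambda>x. relu (f x)) \<in> ?A" if "f \<in> ?A" for f
      using that
    proof (elim imageE, hypsubst)
      fix f assume "f \<in> relu_funs ?n"
      then show "(\<lambda>p. relu (f (flat p))) \<in> ?A"
        by (intro A[of "\<lambda>x. relu (f x)"] relu_funs_relu)
    qed
  qed
  then obtain q where q: "q \<in> ?A" "\<forall>x\<in>C. \<bar>g x - q x\<bar> < e" ..
  from q(1) obtain f where f: "q = (\<lambda>p. f (flat p))" "f \<in> relu_funs ?n" by (rule imageE)
  show ?thesis using q(2) unfolding f(1) by (rule bexI[OF _ f(2)])
qed


subsection \<open>Encoding the cell of a point\<close>

definition cell_code :: "'d::finite ineqs list \<Rightarrow> real^'d \<Rightarrow> real" where
  "cell_code P x = (\<Sum>l<dim_geom P. 2 ^ l * z_geom P x $ l)"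

lemma dim_T_geom: "dim_vec (T_geom P x) = dim_geom P"
  by (simp add: T_geom_def dim_geom_def)

text \<open>The entries of \<open>z_geom\<close> are bits, and \<open>set_encode\<close> is
  injective on finite sets; equal codes therefore mean equal sign patterns.\<close>

lemma cell_code_eq: "cell_code P x = real (set_encode {l. l < dim_geom P \<and> T_geom P x $ l \<ge> 0})"
proof -
  have "cell_code P x = (\<Sum>l<dim_geom P. if T_geom P x $ l \<ge> 0 then 2 ^ l else 0)"
    unfolding cell_code_def z_geom_def
    by (intro sum.cong) (auto simp: dim_T_geom heaviside_def)
  also have "\<dots> = (\<Sum>l | l < dim_geom P \<and> T_geom P x $ l \<ge> 0. 2 ^ l)"
    by (subst sum.inter_filter[symmetric]) auto
  finally show ?thesis by (simp add: set_encode_def)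
qed

text \<open>Finiteness keeps the union of the pieces over all codes compact and lets continuity be
  checked piece by piece.\<close>

lemma finite_cell_codes: "finite (range (cell_code P))"
proof (rule finite_subset)
  show "range (cell_code P) \<subseteq> (\<lambda>S. real (set_encode S)) ` Pow {..<dim_geom P}"
    by (auto simp: cell_code_eq)
qed simp

text \<open>Equal codes transfer the weak inequality of each row of the system from \<open>x\<close>
  to \<open>y\<close>; off \<open>Gamma_geom P\<close> no row vanishes at \<open>y\<close>, so the
  inequality there is strict.\<close>

lemma cell_code_polyhedron:
  assumes "x \<notin> Gamma_geom P" "y \<notin> Gamma_geom P" "cell_code P x = cell_code P y"
    and "k < length P" "x \<in> open_polyhedron (P ! k)"
  shows "y \<in> open_polyhedron (P ! k)"
proof -
  have "{l. l < dim_geom P \<and> T_geom P x $ l \<ge> 0} = {l. l < dim_geom P \<and> T_geom P y $ l \<ge> 0}"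
    using assms(3) by (simp add: cell_code_eq set_encode_eq)
  then have sign: "T_geom P x $ l \<ge> 0 \<longleftrightarrow> T_geom P y $ l \<ge> 0" if "l < dim_geom P" for l
    using that by blast
  have "inner a y < \<beta>" if "(a, \<beta>) \<in> set (P ! k)" for a \<beta>
  proof -
    have "(a, \<beta>) \<in> set (concat P)" using that assms(4) by (auto intro: nth_mem)
    then obtain l where l: "l < dim_geom P" "concat P ! l = (a, \<beta>)"
      unfolding dim_geom_def by (meson in_set_conv_nth)
    have T: "T_geom P u $ l = \<beta> - inner a u" for u
      using l by (simp add: T_geom_def dim_geom_def vec_of_list_index)
    have "inner a x < \<beta>" using that assms(5) by (auto simp: open_polyhedron_def)
    then have "T_geom P y $ l \<ge> 0" using sign[OF l(1)] by (simp add: T)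
    moreover have "T_geom P y $ l \<noteq> 0" using assms(2) l(1) by (auto simp: Gamma_geom_def)
    ultimately show ?thesis by (simp add: T)
  qed
  then show ?thesis by (auto simp: open_polyhedron_def)
qed

text \<open>Here \<open>d1 = 1\<close>: the inner network outputs just the code, which is linear in
  \<open>z_geom P x\<close> and so is computed by a ReLU network with zero jumps.\<close>

lemma geom_preserving_netsI:
  fixes P :: "'d::finite ineqs list"
  assumes "\<And>j :: 'd. f j \<in> relu_funs (1 + CARD('d) + 1)"
  shows "(\<lambda>(x, t). \<chi> j. f j (flat (x, t, cell_code P x))) \<in> geom_preserving_nets P"
proof -
  define \<Phi> where
    \<comment> \<open>The summand 0 gives the body the shape expected by
      \<open>relu_funs_affine\<close>.\<close>
    "\<Phi> z = Matrix.vec 1 (\<lambda>_. 0 + (\<Sum>l<dim_geom P. 2 ^ l * z $ l))" for z :: "real Matrix.vec"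
  define \<Psi> where "\<Psi> v = Matrix.vec CARD('d) (\<lambda>i. f (coord_enum i) v)" for v
  have "\<Phi> \<in> relu_jump_nets (dim_geom P) 1"
    unfolding \<Phi>_def[abs_def]
    by (intro set_mp[OF relu_nets_subset_relu_jump_nets] relu_funs_realization relu_funs_affine)
  moreover have "\<Psi> \<in> relu_nets (1 + CARD('d) + 1) CARD('d)"
    unfolding \<Psi>_def[abs_def] by (intro relu_funs_realization assms)
  moreover have "\<Phi> (z_geom P x) = vec_of_list [cell_code P x]" for x
    by (intro eq_vecI) (auto simp: \<Phi>_def cell_code_def)
  then have "coords (\<chi> j. f j (flat (x, t, cell_code P x))) =
      \<Psi> (coords x @\<^sub>v vec_of_list [t] @\<^sub>v \<Phi> (z_geom P x))" for x t
    by (simp add: flat_def \<Psi>_def coords_def)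
  ultimately show ?thesis
    unfolding geom_preserving_nets_def
    by (intro CollectI exI[of _ 1] conjI bexI[of _ \<Phi>] bexI[of _ \<Psi>]) auto
qed

section \<open>Assembling the approximation in the maximum norm\<close>

lemma infnorm_le_componentwise:
  fixes x :: "real^'d::finite"
  assumes "\<And>j. \<bar>vec_nth x j\<bar> \<le> e"
  shows "infnorm x \<le> e"
  unfolding infnorm_Max using assms by (auto simp: Basis_vec_def inner_axis)

theorem theorem4p2:
  fixes \<Omega> :: "(real^'d::finite) set"
    and P :: "'d ineqs list"
    and F :: "(real^'d) \<times> real \<Rightarrow> real^'d"
    and T \<epsilon> :: real
  assumes "compact \<Omega>"
    and "T > 0"
    and "disjoint_family_on (\<lambda>k. open_polyhedron (P ! k)) {..<length P}"
    and "\<Omega> - Gamma_geom P = (\<Union>k<length P. \<Omega> \<inter> open_polyhedron (P ! k))"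
    and "piecewise_smooth \<Omega> P F"
    and "\<epsilon> > 0"
  shows "\<exists>N \<in> geom_preserving_nets P.
    (SUP (x, t) \<in> (\<Omega> - Gamma_geom P) \<times> {0..T}. ereal (infnorm (F (x, t) - N (x, t)))) < ereal \<epsilon>"
proof -
  define S where "S c = {x \<in> \<Omega> - Gamma_geom P. cell_code P x = c}" for c
  define K where "K c = closure (S c) \<times> {0..T} \<times> {c}" for c
  define I where "I = range (cell_code P)"
  have "\<exists>Fc. continuous_on (closure (S c) \<times> UNIV) Fc \<and> (\<forall>x\<in>S c. \<forall>t. F (x, t) = Fc (x, t))" for c
  proof (cases "S c = {}")
    case True
    then show ?thesis by auto
  next
    case False
    then obtain x where x: "x \<in> \<Omega> - Gamma_geom P" "cell_code P x = c" by (auto simp: S_def)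
    then obtain k where k: "k < length P" "x \<in> open_polyhedron (P ! k)"
      using assms(4) by blast
    \<comment> \<open>One point of the level set fixes the polyhedron for all of it, so the
      extension belonging to that polyhedron serves for the whole set.\<close>
    have sub: "S c \<subseteq> \<Omega> \<inter> open_polyhedron (P ! k)"
      using x k by (auto simp: S_def intro: cell_code_polyhedron[of x P])
    obtain Fk where Fk: "continuous_on (closure (\<Omega> \<inter> open_polyhedron (P ! k)) \<times> UNIV) Fk"
      "\<forall>x \<in> \<Omega> \<inter> open_polyhedron (P ! k). \<forall>t. F (x, t) = Fk (x, t)"
      using assms(5) k(1) unfolding piecewise_smooth_def by blast
    have "continuous_on (closure (S c) \<times> UNIV) Fk"
      using closure_mono[OF sub] by (intro continuous_on_subset[OF Fk(1)]) auto
    then show ?thesis using Fk(2) sub by blast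
  qed
  then obtain Fc where Fc: "\<And>c. continuous_on (closure (S c) \<times> UNIV) (Fc c)"
    "\<And>c x t. x \<in> S c \<Longrightarrow> F (x, t) = Fc c (x, t)" by metis
  \<comment> \<open>Closures of different level sets may meet, and the extensions may disagree
    there. With the code as a third argument they are values of one function at different
    points.\<close>
  define G where "G = (\<lambda>(x, t, c). Fc c (x, t))"
  define C where "C = (\<Union>c\<in>I. K c)"
  have fin: "finite I" unfolding I_def by (rule finite_cell_codes)
  have "bounded (S c)" for c
    by (rule bounded_subset[OF compact_imp_bounded[OF assms(1)]]) (auto simp: S_def)
  then have K: "compact (K c)" for c
    unfolding K_def by (intro compact_Times) (auto simp: compact_closure)
  then have C: "compact C" unfolding C_def using fin by (intro compact_UN) auto
  have "continuous_on (K c) G" for c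
  proof -
    have "continuous_on (K c) (\<lambda>p. Fc c (fst p, fst (snd p)))"
      by (rule continuous_on_compose2[OF Fc(1)[of c]]) (auto simp: K_def intro!: continuous_intros)
    then show ?thesis
      by (rule continuous_on_eq) (auto simp: K_def G_def)
  qed
  \<comment> \<open>Finitely many closed pieces carry the single function \<open>G\<close>, so
    continuity on each gives continuity on their union.\<close>
  then have G: "continuous_on C G"
    unfolding C_def using fin K
    by (intro continuous_on_closed_Union) (auto simp: compact_imp_closed)
  have "\<exists>f\<in>relu_funs (1 + CARD('d) + 1). \<forall>p\<in>C. \<bar>vec_nth (G p) j - f (flat p)\<bar> < \<epsilon> / 2" for j
    using C assms(6) by (intro relu_funs_dense continuous_intros G) auto
  then obtain f where f: "\<And>j. f j \<in> relu_funs (1 + CARD('d) + 1)"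
    "\<And>j p. p \<in> C \<Longrightarrow> \<bar>vec_nth (G p) j - f j (flat p)\<bar> < \<epsilon> / 2" by metis
  define N where "N = (\<lambda>(x, t). \<chi> j. f j (flat (x, t, cell_code P x)))"
  \<comment> \<open>The margin \<open>\<epsilon> / 2\<close> is kept because passing to the supremum
    preserves only weak bounds.\<close>
  have "infnorm (F (x, t) - N (x, t)) \<le> \<epsilon> / 2"
    if "x \<in> \<Omega> - Gamma_geom P" "t \<in> {0..T}" for x t
  proof (rule infnorm_le_componentwise)
    fix j
    have x: "x \<in> S (cell_code P x)" using that by (simp add: S_def)
    then have "(x, t, cell_code P x) \<in> C"
      using that closure_subset by (fastforce simp: C_def I_def K_def)
    moreover have "F (x, t) = G (x, t, cell_code P x)"
      using Fc(2)[OF x] by (simp add: G_def)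
    ultimately show "\<bar>vec_nth (F (x, t) - N (x, t)) j\<bar> \<le> \<epsilon> / 2"
      using f(2)[of "(x, t, cell_code P x)" j] by (simp add: N_def)
  qed
  \<comment> \<open>The supremum is taken in the extended reals, so an empty index set yields minus
    infinity and is covered as well.\<close>
  then have "(SUP (x, t) \<in> (\<Omega> - Gamma_geom P) \<times> {0..T}. ereal (infnorm (F (x, t) - N (x, t))))
      \<le> ereal (\<epsilon> / 2)"
    by (intro SUP_least) auto
  also have "\<dots> < ereal \<epsilon>" using assms(6) by simp
  finally show ?thesis
    using geom_preserving_netsI[of f P] f(1) unfolding N_def by blast
qed

end
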